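(* Consider the free-terminal-time three-agent differential game with dynamics \begin{align*} \dot R&=\alpha\cos\phi-\cos(\theta-\chi),\\ \dot r&=-\cos\chi-\beta\cos\psi,\\ \dot\theta&=-\frac{\alpha}{R}\sin\phi+\frac1R\sin(\theta-\chi)-\frac{\beta}{r}\sin\psi+\frac1r\sin\chi, \end{align*} given initial values $R_0,r_0,\theta_0$, terminal condition $r(t_f)=r_c$, and objective $\max_{\phi,\psi}\min_{\chi}J$, $J=\int_{t_0}^{t_f}\dot R\,dt$. Let $\lambda_R,\lambda_r,\lambda_\theta$ be the co-states. The Target and Defender optimal control headings $\phi^*,\psi^*$ that maximize the separation between the Target and the Attacker and achieve $r(t_f)=r_c$ are given by $$\sin\psi^*=\frac{\lambda_\theta}{r\sqrt{\lambda_r^2+\lambda_\theta^2/r^2}},\qquad \cos\psi^*=\frac{\lambda_r}{\sqrt{\lambda_r^2+\lambda_\theta^2/r^2}},$$ $$\sin\phi^*=\frac{\lambda_\theta}{R\sqrt{(1-\lambda_R)^2+\lambda_\theta^2/R^2}},\qquad \cos\phi^*=\frac{1-\lambda_R}{\sqrt{(1-\lambda_R)^2+\lambda_\theta^2/R^2}}.$$ The Attacker optimal control heading $\chi^*$ that minimizes the separation between itself and the Target at $t=t_f$ is given by $$\sin\chi^*=\frac{\chi_s}{\sqrt{\chi_s^2+\chi_c^2}},\qquad \cos\chi^*=\frac{\chi_c}{\sqrt{\chi_s^2+\chi_c^2}},$$ where $$\chi_s=(1-\lambda_R)\sin\theta-\frac{\lambda_\theta}{R}\cos\theta+\frac{\lambda_\theta}{r},\qquad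 \chi_c=(1-\lambda_R)\cos\theta+\frac{\lambda_\theta}{R}\sin\theta-\lambda_r.$$ (Each formula is understood at times where its denominator is nonzero.)
   Context: A Target, an Attacker and a Defender move in the plane with constant speeds $V_T,V_A,V_D$ and simple motion (they control their headings); $\alpha=V_T/V_A\in(0,1)$, $\beta=V_D/V_A>1$. $R>0$ is the Attacker–Target separation, $r>0$ the Attacker–Defender separation, $\theta$ the angle at the Attacker between the corresponding two segments. The controls are the relative headings $\phi$ (Target), $\psi$ (Defender), $\chi$ (Attacker). Speeds are normalized by $V_A$. $r_c$ is the Defender's capture radius, and $t_f$ (free) is the time at which $r(t_f)=r_c$. The Target–Defender team maximizes $R(t_f)$ and the Attacker minimizes it; equivalently the team minimizes $-J$ and the Attacker maximizes $-J$. The Hamiltonian (for the objective $-J$) is \begin{align*} H=&\cos(\theta-\chi)-\alpha\cos\phi+(\alpha\cos\phi-\cos(\theta-\chi))\lambda_R-(\cos\chi+\beta\cos\psi)\lambda_r\\ &+\Big(-\frac{\alpha}{R}\sin\phi+\frac1R\sin(\theta-\chi)-\frac{\beta}{r}\sin\psi+\frac1r\sin\chi\Big)\lambda_\theta, \end{align*} and the co-states satisfy \begin{align*} \dot\lambda_R&=\frac{\lambda_\theta}{R^2}(\sin(\theta-\chi)-\alpha\sin\phi),\\ \dot\lambda_r&=\frac{\lambda_\theta}{r^2}(\sin\chi-\beta\sin\psi),\\ \dot\lambda_\theta&=(1-\lambda_R)\sin(\theta-\chi)-\frac{\lambda_\theta}{R}\cos(\theta-\chi), \end{align*} with terminal conditions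 $r(t_f)=r_c$, $\lambda_R(t_f)=\lambda_\theta(t_f)=0$, and $H=0$ at $t_f$, the last written as $\alpha^2+2(\alpha\beta+\cos\theta(t_f))\lambda_r(t_f)+(\beta^2-1)\lambda_r^2(t_f)-1=0$. Optimality of the headings is meant in the sense of Pontryagin's principle for this game: at each time, with the states and co-states fixed, $\phi^*$ and $\psi^*$ minimize $H$ over $\phi$ and $\psi$, and $\chi^*$ maximizes $H$ over $\chi$. *)

theory Defs
  imports Complex_Main
begin

text \<open>
  Speeds are normalized by the Attacker's speed, so \<open>\<alpha>\<close> and \<open>\<beta>\<close> are the speeds of the Target and
  the Defender. The variables \<open>l_R\<close>, \<open>l_r\<close>, \<open>l_\<theta>\<close> are the co-states of \<open>R\<close>, \<open>r\<close>, \<open>\<theta>\<close>.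
\<close>

definition R_rate :: "real \<Rightarrow> real \<Rightarrow> real \<Rightarrow> real \<Rightarrow> real" where
  "R_rate \<alpha> \<theta> \<phi> \<chi> = \<alpha> * cos \<phi> - cos (\<theta> - \<chi>)"

definition r_rate :: "real \<Rightarrow> real \<Rightarrow> real \<Rightarrow> real" where
  "r_rate \<beta> \<psi> \<chi> = - cos \<chi> - \<beta> * cos \<psi>"

definition \<theta>_rate ::
  "real \<Rightarrow> real \<Rightarrow> real \<Rightarrow> real \<Rightarrow> real \<Rightarrow> real \<Rightarrow> real \<Rightarrow> real \<Rightarrow> real"
where
  "\<theta>_rate \<alpha> \<beta> R r \<theta> \<phi> \<psi> \<chi> =
     - \<alpha> / R * sin \<phi> + 1 / R * sin (\<theta> - \<chi>) - \<beta> / r * sin \<psi> + 1 / r * sin \<chi>"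

definition hamiltonian ::
  "real \<Rightarrow> real \<Rightarrow> real \<Rightarrow> real \<Rightarrow> real \<Rightarrow> real \<Rightarrow> real \<Rightarrow> real \<Rightarrow> real \<Rightarrow> real \<Rightarrow> real \<Rightarrow> real"
where
  "hamiltonian \<alpha> \<beta> R r \<theta> l_R l_r l_\<theta> \<phi> \<psi> \<chi> =
     cos (\<theta> - \<chi>) - \<alpha> * cos \<phi>
     + (\<alpha> * cos \<phi> - cos (\<theta> - \<chi>)) * l_R
     - (cos \<chi> + \<beta> * cos \<psi>) * l_r
     + (- \<alpha> / R * sin \<phi> + 1 / R * sin (\<theta> - \<chi>) - \<beta> / r * sin \<psi> + 1 / r * sin \<chi>) * l_\<theta>"

text \<open>
  The payoff \<open>J\<close> is the integral of \<open>R_rate\<close> and the Hamiltonian belongs to the objective \<open>-J\<close>,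
  which the Target-Defender team minimizes and the Attacker maximizes.
\<close>

lemma hamiltonian_eq:
  "hamiltonian \<alpha> \<beta> R r \<theta> l_R l_r l_\<theta> \<phi> \<psi> \<chi> =
     - R_rate \<alpha> \<theta> \<phi> \<chi> + l_R * R_rate \<alpha> \<theta> \<phi> \<chi> + l_r * r_rate \<beta> \<psi> \<chi>
     + l_\<theta> * \<theta>_rate \<alpha> \<beta> R r \<theta> \<phi> \<psi> \<chi>"
  unfolding hamiltonian_def R_rate_def r_rate_def \<theta>_rate_def by (simp add: algebra_simps)

definition team_optimal ::
  "real \<Rightarrow> real \<Rightarrow> real \<Rightarrow> real \<Rightarrow> real \<Rightarrow> real \<Rightarrow> real \<Rightarrow> real \<Rightarrow> real \<Rightarrow> real \<Rightarrow> real \<Rightarrow> bool"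
where
  "team_optimal \<alpha> \<beta> R r \<theta> l_R l_r l_\<theta> \<phi> \<psi> \<chi> \<longleftrightarrow>
     (\<forall>\<phi>' \<psi>'. hamiltonian \<alpha> \<beta> R r \<theta> l_R l_r l_\<theta> \<phi> \<psi> \<chi>
            \<le> hamiltonian \<alpha> \<beta> R r \<theta> l_R l_r l_\<theta> \<phi>' \<psi>' \<chi>)"

definition attacker_optimal ::
  "real \<Rightarrow> real \<Rightarrow> real \<Rightarrow> real \<Rightarrow> real \<Rightarrow> real \<Rightarrow> real \<Rightarrow> real \<Rightarrow> real \<Rightarrow> real \<Rightarrow> real \<Rightarrow> bool"
where
  "attacker_optimal \<alpha> \<beta> R r \<theta> l_R l_r l_\<theta> \<phi> \<psi> \<chi> \<longleftrightarrow>
     (\<forall>\<chi>'. hamiltonian \<alpha> \<beta> R r \<theta> l_R l_r l_\<theta> \<phi> \<psi> \<chi>'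
          \<le> hamiltonian \<alpha> \<beta> R r \<theta> l_R l_r l_\<theta> \<phi> \<psi> \<chi>)"

definition \<chi>_s :: "real \<Rightarrow> real \<Rightarrow> real \<Rightarrow> real \<Rightarrow> real \<Rightarrow> real" where
  "\<chi>_s R r \<theta> l_R l_\<theta> = (1 - l_R) * sin \<theta> - l_\<theta> / R * cos \<theta> + l_\<theta> / r"

definition \<chi>_c :: "real \<Rightarrow> real \<Rightarrow> real \<Rightarrow> real \<Rightarrow> real \<Rightarrow> real" where
  "\<chi>_c R \<theta> l_R l_r l_\<theta> = (1 - l_R) * cos \<theta> + l_\<theta> / R * sin \<theta> - l_r"

text \<open>
  At the final time, where \<open>l_R = l_\<theta> = 0\<close>, the condition \<open>H = 0\<close> along optimal headings is a quadratic
  equation for \<open>l_r\<close> whenever \<open>l_r \<ge> 0\<close>. (For \<open>l_r < 0\<close> the term \<open>\<alpha> * \<beta>\<close> changes sign.)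
\<close>

lemma terminal_hamiltonian_eq_0_iff:
  assumes "0 < \<alpha>" "0 < \<beta>" "0 \<le> l_r"
    and team: "team_optimal \<alpha> \<beta> R r \<theta> 0 l_r 0 \<phi> \<psi> \<chi>"
    and att: "attacker_optimal \<alpha> \<beta> R r \<theta> 0 l_r 0 \<phi> \<psi> \<chi>"
  shows "hamiltonian \<alpha> \<beta> R r \<theta> 0 l_r 0 \<phi> \<psi> \<chi> = 0 \<longleftrightarrow>
    \<alpha>\<^sup>2 + 2 * (\<alpha> * \<beta> + cos \<theta>) * l_r + (\<beta>\<^sup>2 - 1) * l_r\<^sup>2 - 1 = 0"
proof -
  let ?H = "hamiltonian \<alpha> \<beta> R r \<theta> 0 l_r 0"
  define c where "c = cos \<theta> - l_r"
  define s where "s = sin \<theta>"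
  define q where "q = sqrt (c\<^sup>2 + s\<^sup>2)"
  have H: "?H f p x = c * cos x + s * sin x - \<alpha> * cos f - \<beta> * l_r * cos p" for f p x
    by (simp add: hamiltonian_def c_def s_def cos_diff algebra_simps)
  have "?H \<phi> \<psi> \<chi> \<le> ?H 0 0 \<chi>"
    using team by (simp add: team_optimal_def)
  moreover have "\<alpha> * cos \<phi> \<le> \<alpha>" "\<beta> * l_r * cos \<psi> \<le> \<beta> * l_r"
    using assms(1-3) by (simp_all add: mult_left_le)
  ultimately have 1: "?H \<phi> \<psi> \<chi> = c * cos \<chi> + s * sin \<chi> - \<alpha> - \<beta> * l_r"
    by (simp add: H)
  have 2: "c * cos \<chi> + s * sin \<chi> \<le> q"
  proof -
    have "(c * cos \<chi> + s * sin \<chi>)\<^sup>2 + (c * sin \<chi> - s * cos \<chi>)\<^sup>2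
        = (c\<^sup>2 + s\<^sup>2) * ((sin \<chi>)\<^sup>2 + (cos \<chi>)\<^sup>2)"
      by algebra
    then have "(c * cos \<chi> + s * sin \<chi>)\<^sup>2 \<le> c\<^sup>2 + s\<^sup>2"
      by (metis le_add_same_cancel1 mult.right_neutral sin_cos_squared_add zero_le_power2)
    then show ?thesis unfolding q_def by (rule real_le_rsqrt)
  qed
  have "\<exists>x. c * cos x + s * sin x = q"
  proof (cases "q = 0")
    case True
    then have "c = 0 \<and> s = 0" by (simp add: q_def sum_power2_eq_zero_iff)
    then show ?thesis using True by simp
  next
    case False
    have qq: "q\<^sup>2 = c\<^sup>2 + s\<^sup>2" by (simp add: q_def)
    have "(c / q)\<^sup>2 + (s / q)\<^sup>2 = 1"
      using False by (simp add: power_divide flip: add_divide_distrib qq)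
    then obtain x where "c / q = cos x" "s / q = sin x"
      using sincos_total_2pi by metis
    then have "c * cos x + s * sin x = (c\<^sup>2 + s\<^sup>2) / q"
      by (simp add: power2_eq_square add_divide_distrib flip: \<open>c / q = cos x\<close> \<open>s / q = sin x\<close>)
    also have "\<dots> = q" unfolding qq[symmetric] using False by (simp add: power2_eq_square)
    finally show ?thesis by blast
  qed
  then obtain x where "c * cos x + s * sin x = q" by blast
  moreover have "?H \<phi> \<psi> x \<le> ?H \<phi> \<psi> \<chi>"
    using att by (simp add: attacker_optimal_def)
  ultimately have "c * cos \<chi> + s * sin \<chi> = q"
    using 2 by (simp add: H)
  with 1 have "?H \<phi> \<psi> \<chi> = 0 \<longleftrightarrow> q = \<alpha> + \<beta> * l_r" by auto
  also have "\<dots> \<longleftrightarrow> q\<^sup>2 = (\<alpha> + \<beta> * l_r)\<^sup>2"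
    using assms(1-3) by (simp add: q_def power2_eq_iff_nonneg del: real_sqrt_pow2_iff real_sqrt_pow2)
  also have "q\<^sup>2 = (cos \<theta> - l_r)\<^sup>2 + (sin \<theta>)\<^sup>2" by (simp add: q_def c_def s_def)
  also have "\<dots> = 1 - 2 * l_r * cos \<theta> + l_r\<^sup>2"
    using sin_cos_squared_add[of \<theta>] by (simp add: power2_diff algebra_simps)
  finally show ?thesis by (auto simp: power2_eq_square algebra_simps)
qed

end

theory Submission
  imports Defs
begin

text \<open>
  For fixed state and co-states the Hamiltonian is a sum of three terms, each depending on a single
  heading \<open>x\<close> through \<open>a cos x + b sin x\<close>. By Cauchy--Schwarz such a term is extremal exactly when
  the unit vector \<open>(cos x, sin x)\<close> points along \<open>(a, b)\<close> or against it.
\<close>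

lemma cos_sin_combination_maximizer:
  fixes a b x :: real
  defines "q \<equiv> sqrt (a\<^sup>2 + b\<^sup>2)"
  assumes max: "\<And>y. a * cos y + b * sin y \<le> a * cos x + b * sin x"
    and "q \<noteq> 0"
  shows "sin x = b / q" "cos x = a / q"
proof -
  have qq: "a\<^sup>2 + b\<^sup>2 = q\<^sup>2" and q: "0 < q"
    using \<open>q \<noteq> 0\<close> by (simp_all add: q_def order_less_le)
  \<comment> \<open>After normalization \<open>(a, b)\<close> lies on the unit circle, so it has an
    angle \<open>y\<close>. This \<open>y\<close> is the competitor against which maximality of
    \<open>x\<close> is tested.\<close>
  have "(a / q)\<^sup>2 + (b / q)\<^sup>2 = 1"
    using q by (simp add: power_divide qq flip: add_divide_distrib)
  then obtain y where "a / q = cos y" "b / q = sin y"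
    using sincos_total_2pi by metis
  then have y: "a = q * cos y" "b = q * sin y"
    using q by (simp_all add: field_simps)
  \<comment> \<open>At \<open>y\<close> the combination takes the value \<open>q\<close>, since
    \<open>cos y\<close> and \<open>sin y\<close> have squares summing to 1; maximality makes the
    value at \<open>x\<close> at least that.\<close>
  have "q * 1 \<le> q * (cos y * cos x + sin y * sin x)"
    using max[of y] qq q unfolding y
    by (simp add: algebra_simps flip: power2_eq_square distrib_left)
  then have "1 \<le> cos y * cos x + sin y * sin x"
    using q by (simp only: mult_le_cancel_left_pos)
  \<comment> \<open>The squared distance of two points on the unit circle is 2 minus twice their
    inner product. An inner product of at least 1 therefore makes them coincide, which is the
    equality case of Cauchy--Schwarz.\<close>
  moreover have "(cos x - cos y)\<^sup>2 + (sin x - sin y)\<^sup>2 = 2 - 2 * (cos y * cos x + sin y * sin x)"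
    using sin_cos_squared_add[of x] sin_cos_squared_add[of y]
    by (simp add: power2_diff algebra_simps)
  ultimately have "(cos x - cos y)\<^sup>2 + (sin x - sin y)\<^sup>2 \<le> 0" by simp
  then have "cos x = cos y" "sin x = sin y"
    by (simp_all add: sum_power2_le_zero_iff)
  then show "sin x = b / q" "cos x = a / q" using q by (simp_all add: y)
qed

text \<open>Expanding the sine and cosine of \<open>\<theta> - \<chi>\<close> exposes
  \<open>\<chi>_c\<close> and \<open>\<chi>_s\<close> as the coefficients of
  \<open>cos \<chi>\<close> and \<open>sin \<chi>\<close>. The minus signs before
  \<open>\<alpha>\<close> and \<open>\<beta>\<close> turn minimization by the team into maximization
  of the two brackets.\<close>

lemma hamiltonian_separated:
  "hamiltonian \<alpha> \<beta> R r \<theta> l_R l_r l_\<theta> \<phi> \<psi> \<chi> =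
     (\<chi>_c R \<theta> l_R l_r l_\<theta> * cos \<chi> + \<chi>_s R r \<theta> l_R l_\<theta> * sin \<chi>)
     - \<alpha> * ((1 - l_R) * cos \<phi> + l_\<theta> / R * sin \<phi>)
     - \<beta> * (l_r * cos \<psi> + l_\<theta> / r * sin \<psi>)"
  by (simp add: hamiltonian_def \<chi>_c_def \<chi>_s_def cos_diff sin_diff algebra_simps diff_divide_distrib)

text \<open>The Defender steers along the vector with components \<open>l_r\<close> and
  \<open>l_\<theta> / r\<close>, whose length is the denominator in both formulas.\<close>

lemma team_optimal_defender_heading:
  assumes "team_optimal \<alpha> \<beta> R r \<theta> l_R l_r l_\<theta> \<phi> \<psi> \<chi>" "0 < \<beta>"
    and "sqrt (l_r\<^sup>2 + l_\<theta>\<^sup>2 / r\<^sup>2) \<noteq> 0"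
  shows "sin \<psi> = l_\<theta> / (r * sqrt (l_r\<^sup>2 + l_\<theta>\<^sup>2 / r\<^sup>2))"
    and "cos \<psi> = l_r / sqrt (l_r\<^sup>2 + l_\<theta>\<^sup>2 / r\<^sup>2)"
proof -
  have "l_r * cos y + l_\<theta> / r * sin y \<le> l_r * cos \<psi> + l_\<theta> / r * sin \<psi>" for y
  proof -
    \<comment> \<open>Joint minimality is tested on a deviation in \<psi> alone, so the terms in
      \<phi> and \<chi> cancel.\<close>
    have "hamiltonian \<alpha> \<beta> R r \<theta> l_R l_r l_\<theta> \<phi> \<psi> \<chi> \<le> hamiltonian \<alpha> \<beta> R r \<theta> l_R l_r l_\<theta> \<phi> y \<chi>"
      using assms(1) by (simp add: team_optimal_def)
    then have "\<beta> * (l_r * cos y + l_\<theta> / r * sin y) \<le> \<beta> * (l_r * cos \<psi> + l_\<theta> / r * sin \<psi>)"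
      unfolding hamiltonian_separated by linarith
    then show ?thesis using \<open>0 < \<beta>\<close> by (simp only: mult_le_cancel_left_pos)
  qed
  from cos_sin_combination_maximizer[OF this] assms(3)
  show "sin \<psi> = l_\<theta> / (r * sqrt (l_r\<^sup>2 + l_\<theta>\<^sup>2 / r\<^sup>2))"
    and "cos \<psi> = l_r / sqrt (l_r\<^sup>2 + l_\<theta>\<^sup>2 / r\<^sup>2)"
    by (simp_all add: power_divide)
qed

text \<open>The argument for the Defender applies to the vector with components
  \<open>1 - l_R\<close> and \<open>l_\<theta> / R\<close>. The 1 in \<open>1 - l_R\<close> comes
  from the running payoff, which contributes \<open>- R_rate\<close> to the Hamiltonian.\<close>

lemma team_optimal_target_heading:
  assumes "team_optimal \<alpha> \<beta> R r \<theta> l_R l_r l_\<theta> \<phi> \<psi> \<chi>" "0 < \<alpha>"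
    and "sqrt ((1 - l_R)\<^sup>2 + l_\<theta>\<^sup>2 / R\<^sup>2) \<noteq> 0"
  shows "sin \<phi> = l_\<theta> / (R * sqrt ((1 - l_R)\<^sup>2 + l_\<theta>\<^sup>2 / R\<^sup>2))"
    and "cos \<phi> = (1 - l_R) / sqrt ((1 - l_R)\<^sup>2 + l_\<theta>\<^sup>2 / R\<^sup>2)"
proof -
  have "(1 - l_R) * cos y + l_\<theta> / R * sin y \<le> (1 - l_R) * cos \<phi> + l_\<theta> / R * sin \<phi>" for y
  proof -
    have "hamiltonian \<alpha> \<beta> R r \<theta> l_R l_r l_\<theta> \<phi> \<psi> \<chi> \<le> hamiltonian \<alpha> \<beta> R r \<theta> l_R l_r l_\<theta> y \<psi> \<chi>"
      using assms(1) by (simp add: team_optimal_def)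
    then have "\<alpha> * ((1 - l_R) * cos y + l_\<theta> / R * sin y)
        \<le> \<alpha> * ((1 - l_R) * cos \<phi> + l_\<theta> / R * sin \<phi>)"
      unfolding hamiltonian_separated by linarith
    then show ?thesis using \<open>0 < \<alpha>\<close> by (simp only: mult_le_cancel_left_pos)
  qed
  from cos_sin_combination_maximizer[OF this] assms(3)
  show "sin \<phi> = l_\<theta> / (R * sqrt ((1 - l_R)\<^sup>2 + l_\<theta>\<^sup>2 / R\<^sup>2))"
    and "cos \<phi> = (1 - l_R) / sqrt ((1 - l_R)\<^sup>2 + l_\<theta>\<^sup>2 / R\<^sup>2)"
    by (simp_all add: power_divide)
qed

text \<open>The bracket in \<chi> enters the Hamiltonian with a plus sign and the Attacker
  maximizes, so the heading points along \<open>(c, s)\<close> itself.\<close>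

lemma attacker_optimal_heading:
  assumes "attacker_optimal \<alpha> \<beta> R r \<theta> l_R l_r l_\<theta> \<phi> \<psi> \<chi>"
  defines "s \<equiv> \<chi>_s R r \<theta> l_R l_\<theta>" and "c \<equiv> \<chi>_c R \<theta> l_R l_r l_\<theta>"
  assumes "sqrt (s\<^sup>2 + c\<^sup>2) \<noteq> 0"
  shows "sin \<chi> = s / sqrt (s\<^sup>2 + c\<^sup>2)" and "cos \<chi> = c / sqrt (s\<^sup>2 + c\<^sup>2)"
proof -
  have "c * cos y + s * sin y \<le> c * cos \<chi> + s * sin \<chi>" for y
    using assms(1) by (simp add: attacker_optimal_def hamiltonian_separated s_def c_def)
  from cos_sin_combination_maximizer[OF this] assms(4)
  show "sin \<chi> = s / sqrt (s\<^sup>2 + c\<^sup>2)" and "cos \<chi> = c / sqrt (s\<^sup>2 + c\<^sup>2)"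
    by (simp_all add: add.commute)
qed

theorem proposition1:
  fixes \<alpha> \<beta> t\<^sub>0 t\<^sub>f R\<^sub>0 r\<^sub>0 \<theta>\<^sub>0 r\<^sub>c :: real
    and R r \<theta> l_R l_r l_\<theta> \<phi> \<psi> \<chi> :: "real \<Rightarrow> real"
  assumes speeds: "0 < \<alpha>" "\<alpha> < 1" "1 < \<beta>"
    and interval: "t\<^sub>0 \<le> t\<^sub>f"
    and pos: "\<And>t. t \<in> {t\<^sub>0..t\<^sub>f} \<Longrightarrow> 0 < R t" "\<And>t. t \<in> {t\<^sub>0..t\<^sub>f} \<Longrightarrow> 0 < r t"
    and initial: "R t\<^sub>0 = R\<^sub>0" "r t\<^sub>0 = r\<^sub>0" "\<theta> t\<^sub>0 = \<theta>\<^sub>0"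
    and dynamics:
      "\<And>t. t \<in> {t\<^sub>0..t\<^sub>f} \<Longrightarrow>
         (R has_real_derivative R_rate \<alpha> (\<theta> t) (\<phi> t) (\<chi> t)) (at t within {t\<^sub>0..t\<^sub>f})"
      "\<And>t. t \<in> {t\<^sub>0..t\<^sub>f} \<Longrightarrow>
         (r has_real_derivative r_rate \<beta> (\<psi> t) (\<chi> t)) (at t within {t\<^sub>0..t\<^sub>f})"
      "\<And>t. t \<in> {t\<^sub>0..t\<^sub>f} \<Longrightarrow>
         (\<theta> has_real_derivative \<theta>_rate \<alpha> \<beta> (R t) (r t) (\<theta> t) (\<phi> t) (\<psi> t) (\<chi> t))
           (at t within {t\<^sub>0..t\<^sub>f})"
    and costates:
      "\<And>t. t \<in> {t\<^sub>0..t\<^sub>f} \<Longrightarrow>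
         (l_R has_real_derivative l_\<theta> t / (R t)\<^sup>2 * (sin (\<theta> t - \<chi> t) - \<alpha> * sin (\<phi> t)))
           (at t within {t\<^sub>0..t\<^sub>f})"
      "\<And>t. t \<in> {t\<^sub>0..t\<^sub>f} \<Longrightarrow>
         (l_r has_real_derivative l_\<theta> t / (r t)\<^sup>2 * (sin (\<chi> t) - \<beta> * sin (\<psi> t)))
           (at t within {t\<^sub>0..t\<^sub>f})"
      "\<And>t. t \<in> {t\<^sub>0..t\<^sub>f} \<Longrightarrow>
         (l_\<theta> has_real_derivative
            (1 - l_R t) * sin (\<theta> t - \<chi> t) - l_\<theta> t / R t * cos (\<theta> t - \<chi> t))
           (at t within {t\<^sub>0..t\<^sub>f})"
    and terminal: "r t\<^sub>f = r\<^sub>c" "l_R t\<^sub>f = 0" "l_\<theta> t\<^sub>f = 0"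
      "hamiltonian \<alpha> \<beta> (R t\<^sub>f) (r t\<^sub>f) (\<theta> t\<^sub>f) (l_R t\<^sub>f) (l_r t\<^sub>f) (l_\<theta> t\<^sub>f) (\<phi> t\<^sub>f) (\<psi> t\<^sub>f) (\<chi> t\<^sub>f) = 0"
    and team:
      "\<And>t. t \<in> {t\<^sub>0..t\<^sub>f} \<Longrightarrow>
         team_optimal \<alpha> \<beta> (R t) (r t) (\<theta> t) (l_R t) (l_r t) (l_\<theta> t) (\<phi> t) (\<psi> t) (\<chi> t)"
    and attacker:
      "\<And>t. t \<in> {t\<^sub>0..t\<^sub>f} \<Longrightarrow>
         attacker_optimal \<alpha> \<beta> (R t) (r t) (\<theta> t) (l_R t) (l_r t) (l_\<theta> t) (\<phi> t) (\<psi> t) (\<chi> t)"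
  shows "\<forall>t\<in>{t\<^sub>0..t\<^sub>f}.
    (let d = sqrt ((l_r t)\<^sup>2 + (l_\<theta> t)\<^sup>2 / (r t)\<^sup>2) in
       d \<noteq> 0 \<longrightarrow> sin (\<psi> t) = l_\<theta> t / (r t * d) \<and> cos (\<psi> t) = l_r t / d) \<and>
    (let d = sqrt ((1 - l_R t)\<^sup>2 + (l_\<theta> t)\<^sup>2 / (R t)\<^sup>2) in
       d \<noteq> 0 \<longrightarrow> sin (\<phi> t) = l_\<theta> t / (R t * d) \<and> cos (\<phi> t) = (1 - l_R t) / d) \<and>
    (let s = \<chi>_s (R t) (r t) (\<theta> t) (l_R t) (l_\<theta> t);
         c = \<chi>_c (R t) (\<theta> t) (l_R t) (l_r t) (l_\<theta> t);
         d = sqrt (s\<^sup>2 + c\<^sup>2) in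
       d \<noteq> 0 \<longrightarrow> sin (\<chi> t) = s / d \<and> cos (\<chi> t) = c / d)"
  \<comment> \<open>The claim is pointwise in \<open>t\<close>: each conjunct is one heading lemma
    at that time, with \<open>d \<noteq> 0\<close> as its nondegeneracy condition, and
    \<open>speeds\<close> gives the positivity of \<alpha> and \<beta>.\<close>
  using team_optimal_defender_heading[OF team] team_optimal_target_heading[OF team]
    attacker_optimal_heading[OF attacker] speeds
  by (simp add: Let_def)

end
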